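(* Let $R$ be a commutative ring with nonzero identity such that every proper $2$-generated ideal of $R$ has an $OA$-factorization. Then $\dim(R)\leq 1$.
   Context: All rings are commutative with nonzero identity; $\dim(R)$ denotes the Krull dimension of $R$. An ideal $I$ of a ring $R$ is proper if $I\neq R$. An ideal $I$ is $2$-generated if $I=xR+yR$ for some (not necessarily distinct) $x,y\in R$. A proper ideal $I$ of $R$ is an $OA$-ideal ($1$-absorbing prime ideal) if whenever $a,b,c\in R$ are nonunits with $abc\in I$, then $ab\in I$ or $c\in I$. An $OA$-factorization of a proper ideal $I$ is an expression $I=\prod_{i=1}^n J_i$ ($n\ge 1$) as a product of $OA$-ideals $J_i$. *)

theory Defs
  imports "HOL-Algebra.Ideal_Product" "HOL-Library.Extended_Nat"
begin

text \<open>The value is \<open>\<infinity>\<close> if there are prime chains of unbounded length. For the zero ring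
  the supremum is over the empty set, hence \<open>0\<close>.\<close>

definition krull_dim :: "('a, 'b) ring_scheme \<Rightarrow> enat" where
  "krull_dim R = Sup {enat n | n. \<exists>Ps. length Ps = Suc n \<and>
     (\<forall>P\<in>set Ps. primeideal P R) \<and> sorted_wrt (\<subset>) Ps}"

definition proper_ideal :: "'a set \<Rightarrow> ('a, 'b) ring_scheme \<Rightarrow> bool" where
  "proper_ideal I R \<longleftrightarrow> ideal I R \<and> I \<noteq> carrier R"

definition two_generated :: "('a, 'b) ring_scheme \<Rightarrow> 'a set \<Rightarrow> bool" where
  "two_generated R I \<longleftrightarrow>
     (\<exists>x\<in>carrier R. \<exists>y\<in>carrier R. I = PIdl\<^bsub>R\<^esub> x <+>\<^bsub>R\<^esub> PIdl\<^bsub>R\<^esub> y)"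

definition OA_ideal :: "'a set \<Rightarrow> ('a, 'b) ring_scheme \<Rightarrow> bool" where
  "OA_ideal I R \<longleftrightarrow> proper_ideal I R \<and>
     (\<forall>a\<in>carrier R - Units R. \<forall>b\<in>carrier R - Units R. \<forall>c\<in>carrier R - Units R.
        a \<otimes>\<^bsub>R\<^esub> b \<otimes>\<^bsub>R\<^esub> c \<in> I \<longrightarrow> a \<otimes>\<^bsub>R\<^esub> b \<in> I \<or> c \<in> I)"

text \<open>\<^term>\<open>carrier R\<close> is the neutral element of \<^const>\<open>ideal_prod\<close> on ideals, so the fold is
  the product of the listed ideals.\<close>

definition OA_factorization :: "('a, 'b) ring_scheme \<Rightarrow> 'a set list \<Rightarrow> 'a set \<Rightarrow> bool" where
  "OA_factorization R Js I \<longleftrightarrow> Js \<noteq> [] \<and> (\<forall>J\<in>set Js. OA_ideal J R) \<and>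
     I = foldr (ideal_prod R) Js (carrier R)"

end

theory Submission
  imports Defs
begin

text \<open>Fix a prime \<open>M\<close> and argue locally at \<open>M\<close>. An OA-ideal is prime or contains \<open>M\<^sup>2\<close>. The key
  claim is that every prime \<open>Q \<subset> M\<close> satisfies \<open>Q = MQ\<close> locally. Granted this, if \<open>y \<in> Q\<close> then
  \<open>yR = JK\<close> with a prime \<open>J \<subseteq> Q\<close>, so that locally \<open>yR = MJK = M(yR)\<close> and \<open>y = 0\<close>. Hence primes
  strictly below \<open>M\<close> vanish locally, and no prime chain \<open>P \<subset> Q \<subset> M\<close> exists.

  For the claim, factoring \<open>(p, w\<^sup>3)\<close> with \<open>p \<in> Q\<close>, \<open>w \<in> M - Q\<close> gives \<open>Q \<subseteq> M\<^sup>2\<close>. If \<open>M \<noteq> M\<^sup>2\<close>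
  locally, then for \<open>x \<in> M - M\<^sup>2\<close> one finds \<open>Q \<subseteq> M\<^sup>2 \<subseteq> xR\<close> with \<open>x \<notin> Q\<close>, so \<open>Q = xQ\<close>. If
  \<open>M = M\<^sup>2\<close> locally, all OA-ideals below \<open>M\<close> are prime. A \<open>p \<in> Q - MQ\<close> then generates a prime
  locally, which may be taken as \<open>Q\<close>; some prime \<open>N\<close> equals \<open>jR + Q\<close> with \<open>j \<notin> Q\<close>, and factoring
  \<open>(p, j\<^sup>2)\<close> shows \<open>p \<in> N\<^sup>2 \<subseteq> j\<^sup>2R + MQ\<close>. As \<open>j \<notin> Q\<close>, this puts \<open>p\<close> into \<open>MQ\<close>.\<close>

section \<open>Sums, products and principal ideals\<close>

lemma (in ring) in_ideal_sumI: "i \<in> I \<Longrightarrow> j \<in> J \<Longrightarrow> i \<oplus> j \<in> I <+> J"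
  by (auto simp: set_add_def')

lemma (in ring) in_ideal_sumE:
  fixes x :: 'a
  assumes "x \<in> I <+> J"
  obtains i j where "i \<in> I" "j \<in> J" "x = i \<oplus> j"
  using assms by (auto simp: set_add_def')

lemma (in ring) ideal_add_closed: "ideal I R \<Longrightarrow> x \<in> I \<Longrightarrow> y \<in> I \<Longrightarrow> x \<oplus> y \<in> I"
  by (simp add: additive_subgroup.a_closed ideal.axioms(1))

lemma (in ring) ideal_minus_closed:
  assumes "ideal I R" "x \<in> I" "y \<in> I"
  shows "x \<ominus> y \<in> I"
  using assms by (simp add: a_minus_def additive_subgroup.a_closed additive_subgroup.a_inv_closed ideal.axioms(1))

lemma (in ring) ideal_sum_subset:
  fixes I J K :: "'a set"
  assumes "ideal K R" "I \<subseteq> K" "J \<subseteq> K"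
  shows "I <+> J \<subseteq> K"
  using assms by (auto elim!: in_ideal_sumE intro: ideal_add_closed)

lemma (in ring) subset_ideal_sum:
  fixes I J :: "'a set"
  assumes "ideal I R" "ideal J R"
  shows "I \<subseteq> I <+> J" "J \<subseteq> I <+> J"
proof -
  have "\<zero> \<in> I" "\<zero> \<in> J"
    using assms by (auto intro: additive_subgroup.zero_closed ideal.axioms(1))
  with in_ideal_sumI[of _ I \<zero> J] in_ideal_sumI[of \<zero> I _ J] assms
  show "I \<subseteq> I <+> J" "J \<subseteq> I <+> J"
    by (metis ideal.Icarr r_zero subsetI, metis ideal.Icarr l_zero subsetI)
qed

lemma (in ring) ideal_prod_subset:
  assumes "ideal K R" "\<And>i j. i \<in> I \<Longrightarrow> j \<in> J \<Longrightarrow> i \<otimes> j \<in> K"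
  shows "I \<cdot> J \<subseteq> K"
proof
  fix x assume "x \<in> I \<cdot> J" then show "x \<in> K"
    by induction (use assms in \<open>auto intro: ideal_add_closed\<close>)
qed

lemma (in cring) ideal_prod_mono:
  "A \<subseteq> C \<Longrightarrow> B \<subseteq> D \<Longrightarrow> ideal C R \<Longrightarrow> ideal D R \<Longrightarrow> A \<cdot> B \<subseteq> C \<cdot> D"
  by (intro ideal_prod_subset ideal_prod_is_ideal) (auto intro: ideal_prod.prod)

lemma (in cring) ideal_closedI:
  assumes "I \<subseteq> carrier R" "\<zero> \<in> I" "\<And>x y. x \<in> I \<Longrightarrow> y \<in> I \<Longrightarrow> x \<oplus> y \<in> I"
    and "\<And>r x. r \<in> carrier R \<Longrightarrow> x \<in> I \<Longrightarrow> r \<otimes> x \<in> I"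
  shows "ideal I R"
proof (rule idealI[OF ring_axioms])
  have "\<ominus> x \<in> I" if "x \<in> I" for x
    using assms(4)[of "\<ominus> \<one>" x] that assms(1) by (auto simp: l_minus)
  then show "subgroup I (add_monoid R)"
    using assms by (intro add.subgroupI) (auto simp flip: a_inv_def)
  show "r \<otimes> x \<in> I" if "x \<in> I" "r \<in> carrier R" for r x
    using assms(4) that by auto
  then show "x \<otimes> r \<in> I" if "x \<in> I" "r \<in> carrier R" for r x
    using that assms(1) by (metis m_comm subsetD)
qed

lemma (in cring) in_PIdlE:
  assumes "x \<in> PIdl a" obtains r where "r \<in> carrier R" "x = r \<otimes> a"
  using assms by (auto simp: cgenideal_def)

lemma (in cring) in_PIdlI: "r \<in> carrier R \<Longrightarrow> r \<otimes> a \<in> PIdl a"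
  by (auto simp: cgenideal_def)

lemma (in cring) PIdl_sum_ideal:
  "x \<in> carrier R \<Longrightarrow> y \<in> carrier R \<Longrightarrow> ideal (PIdl x <+> PIdl y) R"
  by (simp add: add_ideals cgenideal_ideal)

lemma (in cring) PIdl_sum_self:
  assumes "x \<in> carrier R" "y \<in> carrier R"
  shows "x \<in> PIdl x <+> PIdl y" "y \<in> PIdl x <+> PIdl y"
  using assms subset_ideal_sum[of "PIdl x" "PIdl y"] cgenideal_ideal cgenideal_self by blast+

lemma (in cring) in_PIdl_sumE:
  fixes z :: 'a
  assumes "z \<in> PIdl x <+> PIdl y"
  obtains a b where "a \<in> carrier R" "b \<in> carrier R" "z = a \<otimes> x \<oplus> b \<otimes> y"
  using assms by (auto elim!: in_ideal_sumE in_PIdlE)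

text \<open>Multiples of a fixed \<open>x\<close> with coefficients in \<open>M\<close> are closed
  under addition, so a sum of products collapses to a single one. This supplies the one coefficient
  that the Nakayama-type arguments below cancel.\<close>

lemma (in cring) ideal_prod_PIdlE:
  assumes M: "ideal M R" and x: "x \<in> carrier R" and z: "z \<in> M \<cdot> (PIdl x)"
  obtains m where "m \<in> M" "z = m \<otimes> x"
proof -
  from z have "\<exists>m\<in>M. z = m \<otimes> x"
  proof induction
    case (prod i j)
    then obtain r where "r \<in> carrier R" "j = r \<otimes> x" by (auto elim: in_PIdlE)
    with prod M x have "i \<otimes> j = (i \<otimes> r) \<otimes> x" "i \<otimes> r \<in> M"
      by (auto simp: m_assoc ideal.Icarr ideal.I_r_closed)
    then show ?case by blast
  next
    case (sum s1 s2)
    then obtain m1 m2 where "m1 \<in> M" "m2 \<in> M" "s1 = m1 \<otimes> x" "s2 = m2 \<otimes> x" by blast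
    with M x have "s1 \<oplus> s2 = (m1 \<oplus> m2) \<otimes> x" "m1 \<oplus> m2 \<in> M"
      by (auto simp: l_distr ideal.Icarr ideal_add_closed)
    then show ?case by blast
  qed
  with that show ?thesis by blast
qed

section \<open>Prime divisors of finite products, and OA-ideals\<close>

lemma (in cring) foldr_ideal_prod_ideal:
  "\<forall>J\<in>set Js. ideal J R \<Longrightarrow> ideal (foldr (ideal_prod R) Js (carrier R)) R"
  by (induction Js) (auto simp: oneideal ideal_prod_is_ideal)

text \<open>A prime containing a product contains a factor, which commutativity moves to the front.
  The empty product is the whole ring and lies in no prime.\<close>

lemma (in cring) foldr_ideal_prod_remove:
  assumes "\<forall>J\<in>set Js. ideal J R" "primeideal P R" "foldr (ideal_prod R) Js (carrier R) \<subseteq> P"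
  shows "\<exists>J\<in>set Js. J \<subseteq> P \<and>
           (\<exists>K. ideal K R \<and> foldr (ideal_prod R) Js (carrier R) = J \<cdot> K)"
  using assms
proof (induction Js)
  case Nil
  then show ?case
    using primeideal.I_notcarr[OF Nil(2)] ideal.Icarr[OF primeideal.axioms(1)[OF Nil(2)]] by auto
next
  case (Cons J Js)
  let ?K = "foldr (ideal_prod R) Js (carrier R)"
  have J: "ideal J R" and K: "ideal ?K R"
    using Cons.prems foldr_ideal_prod_ideal by auto
  then consider "J \<subseteq> P" | "?K \<subseteq> P"
    using Cons.prems(3) primeideal_divides_ideal_prod[OF Cons.prems(2) J K] by auto
  then show ?case
  proof cases
    case 1
    with K show ?thesis by auto
  next
    case 2
    with Cons obtain J' K' where *: "J' \<in> set Js" "J' \<subseteq> P" "ideal K' R" "?K = J' \<cdot> K'"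
      by auto
    with Cons.prems have J': "ideal J' R" by auto
    have "J \<cdot> (J' \<cdot> K') = J' \<cdot> (J \<cdot> K')"
      using J J' *(3) by (metis ideal_prod_assoc ideal_prod_commute)
    with * J show ?thesis
      using ideal_prod_is_ideal[OF J *(3)] by auto
  qed
qed

text \<open>Take \<open>u\<close>, \<open>v\<close> outside \<open>J\<close> with product in
  \<open>J\<close>; neither is a unit, as a unit could be cancelled. The OA condition for
  \<open>b\<close>, \<open>u\<close>, \<open>v\<close> gives \<open>b \<otimes> u\<close> in
  \<open>J\<close>, and then for \<open>a\<close>, \<open>b\<close>, \<open>u\<close> it gives the
  claim.\<close>

lemma (in cring) nonprime_OA_ideal_nonunit_mult:
  assumes J: "OA_ideal J R" and "\<not> primeideal J R"
    and a: "a \<in> carrier R - Units R" and b: "b \<in> carrier R - Units R"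
  shows "a \<otimes> b \<in> J"
proof -
  have id: "ideal J R" "J \<noteq> carrier R" using J by (auto simp: OA_ideal_def proper_ideal_def)
  have OA: "x \<otimes> y \<in> J \<or> z \<in> J"
    if "x \<in> carrier R - Units R" "y \<in> carrier R - Units R" "z \<in> carrier R - Units R"
      "x \<otimes> y \<otimes> z \<in> J" for x y z
    using J that by (auto simp: OA_ideal_def)
  obtain u v where uv: "u \<in> carrier R" "v \<in> carrier R" "u \<otimes> v \<in> J" "u \<notin> J" "v \<notin> J"
    using ideal.primeidealCD[OF id(1) is_cring assms(2)] id(2) by auto
  have nu: "v \<notin> Units R" "u \<notin> Units R"
  proof -
    show "v \<notin> Units R"
    proof
      assume v: "v \<in> Units R"
      then have "u = inv v \<otimes> (u \<otimes> v)"
        using uv m_lcomm[of "inv v" u v] by (simp add: Units_l_inv)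
      then show False using uv v ideal.I_l_closed[OF id(1) uv(3), of "inv v"] by simp
    qed
    show "u \<notin> Units R"
    proof
      assume u: "u \<in> Units R"
      then have "v = inv u \<otimes> (u \<otimes> v)"
        using uv m_assoc[of "inv u" u v] by (simp add: Units_l_inv)
      then show False using uv u ideal.I_l_closed[OF id(1) uv(3), of "inv u"] by simp
    qed
  qed
  have bu: "b \<otimes> u \<in> J"
    using OA[of b u v] uv nu b ideal.I_l_closed[OF id(1) uv(3), of b] by (auto simp: m_assoc)
  show ?thesis
    using OA[of a b u] uv nu a b ideal.I_l_closed[OF id(1) bu, of a] by (auto simp: m_assoc)
qed

lemma (in cring) prime_nonunit:
  assumes "primeideal P R" "x \<in> P" shows "x \<in> carrier R - Units R"
proof -
  interpret primeideal P R by fact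
  have "x \<notin> Units R"
    using assms(2) I_l_closed[of x "inv x"] one_imp_carrier I_notcarr by (metis Units_inv_closed Units_l_inv)
  then show ?thesis using assms(2) Icarr by auto
qed

lemma (in cring) OA_ideal_square_subset:
  assumes "OA_ideal J R" "\<not> primeideal J R" "primeideal M R"
  shows "M \<cdot> M \<subseteq> J"
  using assms prime_nonunit[OF assms(3)] nonprime_OA_ideal_nonunit_mult[OF assms(1,2)]
  by (intro ideal_prod_subset) (auto simp: OA_ideal_def proper_ideal_def)

text \<open>Otherwise the square of \<open>M\<close> lies in \<open>J\<close>, hence in
  \<open>P\<close>, and primality of \<open>P\<close> forces \<open>M\<close> into
  \<open>P\<close>.\<close>

lemma (in cring) OA_ideal_below_nonmaximal_prime:
  assumes "OA_ideal J R" "J \<subseteq> P" "primeideal P R" "primeideal M R" "P \<subset> M"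
  shows "primeideal J R"
proof (rule ccontr)
  assume "\<not> primeideal J R"
  with assms have "M \<cdot> M \<subseteq> P" using OA_ideal_square_subset by blast
  with assms primeideal_divides_ideal_prod[OF assms(3), of M M] show False
    using primeideal.axioms(1) by auto
qed

section \<open>Saturation at a prime, replacing localization\<close>

text \<open>The contraction to \<open>R\<close> of the extension of \<open>I\<close> to the localization \<open>R\<^sub>M\<close>.\<close>

definition (in ring) sat :: "'a set \<Rightarrow> 'a set \<Rightarrow> 'a set" where
  "sat M I = {x \<in> carrier R. \<exists>s\<in>carrier R - M. s \<otimes> x \<in> I}"

lemma (in ring) satI: "x \<in> carrier R \<Longrightarrow> s \<in> carrier R \<Longrightarrow> s \<notin> M \<Longrightarrow> s \<otimes> x \<in> I \<Longrightarrow> x \<in> sat M I"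
  by (auto simp: sat_def)

lemma (in ring) satE:
  assumes "x \<in> sat M I"
  obtains s where "x \<in> carrier R" "s \<in> carrier R" "s \<notin> M" "s \<otimes> x \<in> I"
  using assms by (auto simp: sat_def)

lemma (in ring) sat_mono: "I \<subseteq> J \<Longrightarrow> sat M I \<subseteq> sat M J"
  by (auto simp: sat_def)

context primeideal
begin

lemma one_notin: "\<one> \<notin> I"
  using one_imp_carrier I_notcarr by auto

lemma mult_notin: "a \<in> carrier R \<Longrightarrow> b \<in> carrier R \<Longrightarrow> a \<notin> I \<Longrightarrow> b \<notin> I \<Longrightarrow> a \<otimes> b \<notin> I"
  using I_prime by auto

lemma minus_notin: "a \<in> carrier R \<Longrightarrow> a \<notin> I \<Longrightarrow> b \<in> I \<Longrightarrow> a \<ominus> b \<notin> I"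
proof
  assume "a \<in> carrier R" "a \<notin> I" "b \<in> I" "a \<ominus> b \<in> I"
  moreover have "a = (a \<ominus> b) \<oplus> b" using \<open>a \<in> carrier R\<close> Icarr[OF \<open>b \<in> I\<close>] by algebra
  ultimately show False using ideal_add_closed[OF is_ideal, of "a \<ominus> b" b] by simp
qed

lemma sat_ideal:
  assumes "ideal J R" shows "ideal (sat I J) R"
proof (rule ideal_closedI)
  interpret J: ideal J R by fact
  show "\<zero> \<in> sat I J"
    using one_notin by (auto intro: satI[of _ \<one>])
  fix x y assume x: "x \<in> sat I J" and y: "y \<in> sat I J"
  from x obtain s where s: "x \<in> carrier R" "s \<in> carrier R" "s \<notin> I" "s \<otimes> x \<in> J" by (rule satE)
  from y obtain t where t: "y \<in> carrier R" "t \<in> carrier R" "t \<notin> I" "t \<otimes> y \<in> J" by (rule satE)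
  have "s \<otimes> t \<otimes> (x \<oplus> y) = t \<otimes> (s \<otimes> x) \<oplus> s \<otimes> (t \<otimes> y)"
    using s(1,2) t(1,2) by algebra
  also have "\<dots> \<in> J" by (rule J.a_closed[OF J.I_l_closed[OF s(4) t(2)] J.I_l_closed[OF t(4) s(2)]])
  finally show "x \<oplus> y \<in> sat I J"
    using mult_notin[OF s(2) t(2) s(3) t(3)] s(1,2) t(1,2) by (intro satI[of _ "s \<otimes> t"]) simp_all
next
  interpret J: ideal J R by fact
  fix r x assume r: "r \<in> carrier R" and x: "x \<in> sat I J"
  from x obtain s where s: "x \<in> carrier R" "s \<in> carrier R" "s \<notin> I" "s \<otimes> x \<in> J" by (rule satE)
  have "s \<otimes> (r \<otimes> x) = r \<otimes> (s \<otimes> x)" using s(1,2) r by algebra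
  also have "\<dots> \<in> J" by (rule J.I_l_closed[OF s(4) r])
  finally show "r \<otimes> x \<in> sat I J" using s r by (intro satI[of _ s]) simp_all
qed (auto simp: sat_def)

lemma subset_sat: "ideal J R \<Longrightarrow> J \<subseteq> sat I J"
  using one_notin ideal.Icarr[of J R] by (auto intro: satI[of _ \<one>])

text \<open>A multiplier outside \<open>I\<close> is also outside \<open>P\<close> and cancels:
  primes inside \<open>I\<close> survive localization at \<open>I\<close> unchanged.\<close>

lemma sat_prime_subset:
  assumes "primeideal P R" "P \<subseteq> I"
  shows "sat I P \<subseteq> P"
  using primeideal.I_prime[OF assms(1)] assms(2) by (auto simp: sat_def)

lemma sat_prod_subset:
  assumes "ideal A R" "ideal B R" "J \<subseteq> sat I A" "K \<subseteq> sat I B"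
  shows "J \<cdot> K \<subseteq> sat I (A \<cdot> B)"
proof (rule ideal_prod_subset[OF sat_ideal[OF ideal_prod_is_ideal[OF assms(1,2)]]])
  fix x y assume "x \<in> J" "y \<in> K"
  with assms have xy: "x \<in> sat I A" "y \<in> sat I B" by auto
  from xy(1) obtain s where s: "x \<in> carrier R" "s \<in> carrier R" "s \<notin> I" "s \<otimes> x \<in> A" by (rule satE)
  from xy(2) obtain t where t: "y \<in> carrier R" "t \<in> carrier R" "t \<notin> I" "t \<otimes> y \<in> B" by (rule satE)
  have "s \<otimes> t \<otimes> (x \<otimes> y) = (s \<otimes> x) \<otimes> (t \<otimes> y)"
    using s(1,2) t(1,2) by algebra
  then show "x \<otimes> y \<in> sat I (A \<cdot> B)"
    using mult_notin[OF s(2) t(2) s(3) t(3)] ideal_prod.prod[OF s(4) t(4), of R] s(1,2) t(1,2)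
    by (intro satI[of _ "s \<otimes> t"]) simp_all
qed

text \<open>An element of \<open>K\<close> outside \<open>I\<close> becomes a unit in the
  localization, so \<open>K\<close> becomes the whole ring there and drops out of the
  product.\<close>

lemma factor_subset_sat_prod:
  assumes "ideal J R" "ideal K R" "\<not> K \<subseteq> I"
  shows "J \<subseteq> sat I (J \<cdot> K)"
proof -
  from assms(3) obtain k where k: "k \<in> K" "k \<notin> I" by blast
  have kc: "k \<in> carrier R" using k(1) by (rule ideal.Icarr[OF assms(2)])
  show ?thesis
  proof
    fix j assume j: "j \<in> J"
    then have jc: "j \<in> carrier R" by (rule ideal.Icarr[OF assms(1)])
    have "k \<otimes> j \<in> J \<cdot> K"
      using ideal_prod.prod[OF j k(1), of R] m_comm[OF jc kc] by simp
    with jc kc k(2) show "j \<in> sat I (J \<cdot> K)" by (rule satI)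
  qed
qed

end

section \<open>Consequences of the factorization hypothesis\<close>

locale two_generated_OA = cring +
  assumes OA_factorization_ex:
    "\<And>I. proper_ideal I R \<Longrightarrow> two_generated R I \<Longrightarrow> \<exists>Js. OA_factorization R Js I"
begin

text \<open>All uses of the hypothesis pass through this form: one OA-factor inside a chosen prime
  is singled out, and the remaining factors are merged into \<open>K\<close>, which may be the whole
  ring.\<close>

lemma two_generated_factor:
  assumes P: "primeideal P R" and xy: "x \<in> P" "y \<in> P"
  obtains J K where "OA_ideal J R" "ideal J R" "ideal K R" "J \<subseteq> P" "PIdl x <+> PIdl y = J \<cdot> K"
proof -
  have P': "ideal P R" using P by (rule primeideal.axioms)
  have carr: "x \<in> carrier R" "y \<in> carrier R" using xy ideal.Icarr[OF P'] by auto
  let ?I = "PIdl x <+> PIdl y :: 'a set"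
  have sub: "?I \<subseteq> P"
    using P' xy by (intro ideal_sum_subset) (auto dest: cgenideal_minimal)
  then have "proper_ideal ?I R"
    using PIdl_sum_ideal[OF carr] primeideal.I_notcarr[OF P] ideal.Icarr[OF P']
    by (auto simp: proper_ideal_def)
  moreover have "two_generated R ?I"
    using carr by (auto simp: two_generated_def)
  ultimately obtain Js where Js: "\<forall>J\<in>set Js. OA_ideal J R" "?I = foldr (ideal_prod R) Js (carrier R)"
    using OA_factorization_ex[of ?I] by (auto simp: OA_factorization_def)
  then have "\<forall>J\<in>set Js. ideal J R" by (auto simp: OA_ideal_def proper_ideal_def)
  with foldr_ideal_prod_remove[OF this P] Js sub that show ?thesis by metis
qed

lemma principal_factor:
  assumes P: "primeideal P R" and x: "x \<in> P"
  obtains J K where "OA_ideal J R" "ideal J R" "ideal K R" "J \<subseteq> P" "PIdl x = J \<cdot> K"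
proof -
  have "ideal (PIdl x) R"
    using x ideal.Icarr[OF primeideal.axioms(1)[OF P]] by (auto intro: cgenideal_ideal)
  then have "PIdl x <+> PIdl x = PIdl x"
    using ideal_sum_subset[of "PIdl x" "PIdl x" "PIdl x"] subset_ideal_sum[of "PIdl x" "PIdl x"] by auto
  with two_generated_factor[OF P x x] that show ?thesis by metis
qed

section \<open>Local divisibility by \<open>M\<close> of primes strictly below
  \<open>M\<close>\<close>

lemma nonmaximal_prime_subset_square:
  assumes M: "primeideal M R" and Q: "primeideal Q R" and QM: "Q \<subset> M"
  shows "Q \<subseteq> M \<cdot> M"
proof
  interpret M: primeideal M R by fact
  interpret Q: primeideal Q R by fact
  fix p assume p: "p \<in> Q"
  obtain w where w: "w \<in> M" "w \<notin> Q" using QM by auto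
  have c: "p \<in> carrier R" "w \<in> carrier R" using p w by auto
  \<comment> \<open>The cube lets the OA condition be applied to the triple \<open>w\<close>,
    \<open>w\<close>, \<open>w\<close>, so that \<open>w \<otimes> w\<close> lies in
    \<open>J\<close>.\<close>
  let ?w3 = "w \<otimes> w \<otimes> w"
  have "p \<in> M" "?w3 \<in> M" using p w QM c M.I_l_closed by auto
  then obtain J K where JK: "OA_ideal J R" "ideal J R" "ideal K R" "J \<subseteq> M"
      "PIdl p <+> PIdl ?w3 = J \<cdot> K"
    by (rule two_generated_factor[OF M])
  have mem: "p \<in> J \<cdot> K" "?w3 \<in> J \<cdot> K"
    using PIdl_sum_self[of p ?w3] c JK(5) by auto
  show "p \<in> M \<cdot> M"
  proof (cases "K \<subseteq> M")
    case True
    with mem(1) ideal_prod_mono[OF JK(4) True] M.is_ideal show ?thesis by auto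
  next
    case False
    have "?w3 \<in> J" using mem(2) ideal_prod_inter[OF JK(2,3)] by auto
    moreover have "w \<in> carrier R - Units R" using prime_nonunit[OF M w(1)] .
    ultimately have "w \<otimes> w \<in> J \<or> w \<in> J" using JK(1) unfolding OA_ideal_def by blast
    then have "w \<otimes> w \<in> J" using ideal.I_l_closed[OF JK(2)] c by auto
    then have "w \<otimes> w \<in> sat M (J \<cdot> K)"
      using M.factor_subset_sat_prod[OF JK(2,3) False] by auto
    then obtain u where u: "u \<in> carrier R" "u \<notin> M" "u \<otimes> (w \<otimes> w) \<in> PIdl p <+> PIdl ?w3"
      unfolding JK(5) by (rule satE)
    then obtain a b where ab: "a \<in> carrier R" "b \<in> carrier R" "u \<otimes> (w \<otimes> w) = a \<otimes> p \<oplus> b \<otimes> ?w3"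
      by (elim in_PIdl_sumE)
    \<comment> \<open>Modulo \<open>Q\<close>, the square of \<open>w\<close> is locally a multiple
      of its cube. Since \<open>u \<ominus> b \<otimes> w\<close> stays outside \<open>M\<close>, it
      cancels and would put \<open>w\<close> into \<open>Q\<close>: the case of \<open>K\<close> not
      inside \<open>M\<close> is impossible.\<close>
    have "(w \<otimes> w) \<otimes> (u \<ominus> b \<otimes> w) = u \<otimes> (w \<otimes> w) \<ominus> b \<otimes> ?w3"
      using c u(1) ab(1,2) by algebra
    also have "\<dots> = a \<otimes> p" unfolding ab(3) using c ab(1,2) by algebra
    finally have "(w \<otimes> w) \<otimes> (u \<ominus> b \<otimes> w) \<in> Q" using Q.I_l_closed p ab by auto
    moreover have "u \<ominus> b \<otimes> w \<notin> M" using M.minus_notin[OF u(1,2)] M.I_l_closed w ab by auto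
    ultimately show ?thesis
      using Q.mult_notin[of "w \<otimes> w" "u \<ominus> b \<otimes> w"] Q.mult_notin[of w w] c w u(1) ab QM by auto
  qed
qed

text \<open>For \<open>x\<close> in \<open>M\<close> but not locally in its square, \<open>K\<close>
  cannot lie in \<open>M\<close>, so \<open>J\<close> is locally generated by \<open>x\<close>. Once
  \<open>J\<close> contains the square of \<open>M\<close>, every \<open>q\<close> in
  \<open>Q\<close> is locally \<open>r \<otimes> x\<close>, and \<open>r\<close> lies in
  \<open>Q\<close> because \<open>x\<close> does not.\<close>

lemma nonmaximal_prime_locally_divisible_if_not_idempotent:
  assumes M: "primeideal M R" and nidem: "\<not> M \<subseteq> sat M (M \<cdot> M)"
    and Q: "primeideal Q R" and QM: "Q \<subset> M"
  shows "Q \<subseteq> sat M (M \<cdot> Q)"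
proof
  interpret M: primeideal M R by fact
  interpret Q: primeideal Q R by fact
  have MM: "ideal (M \<cdot> M) R" using M.is_ideal ideal_prod_is_ideal by auto
  obtain x where x: "x \<in> M" "x \<notin> sat M (M \<cdot> M)" using nidem by auto
  obtain J K where JK: "OA_ideal J R" "ideal J R" "ideal K R" "J \<subseteq> M" "PIdl x = J \<cdot> K"
    using principal_factor[OF M x(1)] .
  have xJK: "x \<in> J \<cdot> K" using JK(5) cgenideal_self[of x] x by auto
  have "\<not> K \<subseteq> M"
    using ideal_prod_mono[OF JK(4) _ M.is_ideal M.is_ideal] xJK M.subset_sat[OF MM] x(2) by blast
  then have J: "J \<subseteq> sat M (PIdl x)"
    unfolding JK(5) using M.factor_subset_sat_prod JK by auto
  have "M \<cdot> M \<subseteq> J"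
  proof (rule ccontr)
    \<comment> \<open>Then \<open>J\<close> is a prime strictly below \<open>M\<close>, so it lies
      in the square of \<open>M\<close> and cannot contain \<open>x\<close>.\<close>
    assume *: "\<not> M \<cdot> M \<subseteq> J"
    then have "primeideal J R" using OA_ideal_square_subset JK(1) M by blast
    moreover have "J \<noteq> M" using * ideal_prod_inter[OF M.is_ideal M.is_ideal] by auto
    ultimately have "J \<subseteq> M \<cdot> M" using JK(4) nonmaximal_prime_subset_square[OF M] by blast
    then show False using xJK x(2) ideal_prod_inter[OF JK(2,3)] M.subset_sat[OF MM] by auto
  qed
  then have QJ: "Q \<subseteq> sat M (PIdl x)"
    using nonmaximal_prime_subset_square[OF M Q QM] J by auto
  have xQ: "x \<notin> Q"
    using nonmaximal_prime_subset_square[OF M Q QM] x(2) M.subset_sat[OF MM] by auto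
  fix q assume q: "q \<in> Q"
  then have "q \<in> sat M (PIdl x)" using QJ by auto
  then obtain u where u: "q \<in> carrier R" "u \<in> carrier R" "u \<notin> M" "u \<otimes> q \<in> PIdl x" by (rule satE)
  then obtain r where r: "r \<in> carrier R" "u \<otimes> q = r \<otimes> x" by (elim in_PIdlE)
  have "r \<otimes> x \<in> Q" using r q u Q.I_l_closed by metis
  then have "r \<in> Q" using Q.I_prime[of r x] r(1) xQ M.Icarr[OF x(1)] by auto
  then have "u \<otimes> q \<in> M \<cdot> Q"
    using r ideal_prod.prod[OF x(1) \<open>r \<in> Q\<close>, of R] x by (auto simp: m_comm)
  then show "q \<in> sat M (M \<cdot> Q)" using u satI by auto
qed

text \<open>If \<open>J\<close> is not prime, it contains all products of two nonunits. A multiplier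
  \<open>t\<close> outside \<open>M\<close> must then be a unit, since otherwise its square would
  lie in \<open>J\<close> and so in \<open>M\<close>. Hence local idempotence is genuine,
  \<open>J\<close> equals \<open>M\<close>, and \<open>J\<close> is prime after all.\<close>

lemma OA_ideal_prime_if_idempotent:
  assumes M: "primeideal M R" and idem: "M \<subseteq> sat M (M \<cdot> M)"
    and J: "OA_ideal J R" "J \<subseteq> M"
  shows "primeideal J R"
proof (rule ccontr)
  interpret M: primeideal M R by fact
  assume notprime: "\<not> primeideal J R"
  note MJ = OA_ideal_square_subset[OF J(1) notprime M]
  interpret J: ideal J R using J(1) by (auto simp: OA_ideal_def proper_ideal_def)
  have "M \<subseteq> J"
  proof
    fix x assume "x \<in> M"
    then have "x \<in> sat M (M \<cdot> M)" using idem by auto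
    then obtain t where t: "x \<in> carrier R" "t \<in> carrier R" "t \<notin> M" "t \<otimes> x \<in> M \<cdot> M" by (rule satE)
    have "t \<in> Units R"
    proof (rule ccontr)
      assume "t \<notin> Units R"
      then have "t \<otimes> t \<in> J" using nonprime_OA_ideal_nonunit_mult[OF J(1) notprime, of t t] t by auto
      then show False using J(2) M.I_prime t by auto
    qed
    have "inv t \<otimes> (t \<otimes> x) \<in> J" using MJ t J.I_l_closed \<open>t \<in> Units R\<close> by auto
    moreover have "inv t \<otimes> (t \<otimes> x) = x"
      using t \<open>t \<in> Units R\<close> by (simp add: Units_l_inv flip: m_assoc)
    ultimately show "x \<in> J" by simp
  qed
  with J(2) M notprime show False by auto
qed

text \<open>Modulo \<open>Q\<close> the ideal generated by \<open>p\<close> and \<open>x\<close>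
  becomes principal, and a factor of a nonzero principal ideal in a local domain is principal. The
  proof carries out this argument elementwise for the factor \<open>N\<close>.\<close>

lemma prime_principal_modulo_if_idempotent:
  assumes M: "primeideal M R" and idem: "M \<subseteq> sat M (M \<cdot> M)"
    and Q: "primeideal Q R" and QM: "Q \<subset> M" and p: "p \<in> Q"
  obtains N j where "primeideal N R" "N \<subseteq> M" "p \<in> N" "j \<in> N" "j \<notin> Q"
    "N \<subseteq> sat M (PIdl j <+> Q)"
proof -
  interpret M: primeideal M R by fact
  interpret Q: primeideal Q R by fact
  obtain x where x: "x \<in> M" "x \<notin> Q" using QM by auto
  have c: "p \<in> carrier R" "x \<in> carrier R" and pM: "p \<in> M" using p x QM by auto
  obtain N K where N: "OA_ideal N R" "ideal N R" and K: "ideal K R" and NM: "N \<subseteq> M"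
    and px: "PIdl p <+> PIdl x = N \<cdot> K"
    using two_generated_factor[OF M pM x(1)] .
  have Nprime: "primeideal N R" by (rule OA_ideal_prime_if_idempotent[OF M idem N(1) NM])
  interpret N: ideal N R by fact
  interpret K: ideal K R by fact
  \<comment> \<open>Modulo \<open>Q\<close> this is \<open>M\<close> times the ideal of
    \<open>x\<close>; a multiple of \<open>x\<close> avoiding it generates the same ideal as
    \<open>x\<close> locally.\<close>
  let ?I = "M \<cdot> (PIdl x) <+> Q :: 'a set"
  have idMx: "ideal (M \<cdot> (PIdl x)) R"
    using ideal_prod_is_ideal[OF M.is_ideal cgenideal_ideal[OF c(2)]] .
  have idI: "ideal ?I R" using add_ideals[OF idMx Q.is_ideal] .
  note subI = subset_ideal_sum[OF idMx Q.is_ideal]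
  have mem: "p \<in> N \<cdot> K" "x \<in> N \<cdot> K"
    using PIdl_sum_self[of p x] c px by auto
  have "x \<notin> ?I"
  proof
    assume "x \<in> ?I"
    then obtain z q where zq: "z \<in> M \<cdot> (PIdl x)" "q \<in> Q" "x = z \<oplus> q" by (rule in_ideal_sumE)
    from ideal_prod_PIdlE[OF M.is_ideal c(2) zq(1)] obtain m where m: "m \<in> M" "z = m \<otimes> x" .
    have mc: "m \<in> carrier R" and qc: "q \<in> carrier R" using m zq by auto
    \<comment> \<open>Nakayama for one generator: \<open>\<one> \<ominus> m\<close> lies outside
      \<open>M\<close>, hence outside \<open>Q\<close>, and cancels.\<close>
    have "(\<one> \<ominus> m) \<otimes> x = x \<ominus> m \<otimes> x" using mc c(2) by algebra
    also have "\<dots> = (m \<otimes> x \<oplus> q) \<ominus> m \<otimes> x" using zq(3) m(2) by simp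
    also have "\<dots> = q" using mc c(2) qc by algebra
    finally have "(\<one> \<ominus> m) \<otimes> x \<in> Q" using zq by simp
    moreover have "\<one> \<ominus> m \<notin> Q" using M.minus_notin[OF one_closed M.one_notin m(1)] QM by auto
    ultimately show False using Q.I_prime[of "\<one> \<ominus> m" x] x(2) mc c(2) by auto
  qed
  then have "\<not> N \<cdot> K \<subseteq> ?I" using mem(2) by auto
  \<comment> \<open>An ideal containing all elementary products contains \<open>N \<cdot> K\<close>,
    so some elementary product escapes \<open>?I\<close>; its first factor will generate
    \<open>N\<close>.\<close>
  then obtain j k where jk: "j \<in> N" "k \<in> K" "j \<otimes> k \<notin> ?I"
    using ideal_prod_subset[OF idI, of N K] by auto
  have jkc: "j \<in> carrier R" "k \<in> carrier R" using jk by auto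
  have jkQ: "j \<notin> Q" "k \<notin> Q"
    using jk(3) subI(2) Q.I_l_closed[of k j] Q.I_r_closed[of j k] jkc by auto
  have "j \<otimes> k \<in> PIdl p <+> PIdl x" unfolding px by (rule ideal_prod.prod[OF jk(1,2)])
  then obtain a r where ar: "a \<in> carrier R" "r \<in> carrier R" "j \<otimes> k = a \<otimes> p \<oplus> r \<otimes> x"
    by (rule in_PIdl_sumE)
  have rM: "r \<notin> M"
  proof
    assume "r \<in> M"
    then have "r \<otimes> x \<oplus> a \<otimes> p \<in> ?I"
      using ideal_prod.prod[of r M x "PIdl x" R] cgenideal_self[OF c(2)] Q.I_l_closed[OF p ar(1)]
      by (intro in_ideal_sumI)
    then show False using jk(3) ar c by (simp add: a_comm)
  qed
  have "N \<subseteq> sat M (PIdl j <+> Q)"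
  proof
    fix n assume n: "n \<in> N"
    then have nc: "n \<in> carrier R" by auto
    have "n \<otimes> k \<in> PIdl p <+> PIdl x" unfolding px by (rule ideal_prod.prod[OF n jk(2)])
    then obtain a' b where ab: "a' \<in> carrier R" "b \<in> carrier R" "n \<otimes> k = a' \<otimes> p \<oplus> b \<otimes> x"
      by (rule in_PIdl_sumE)
    \<comment> \<open>Cross-multiplication eliminates \<open>x\<close>; then \<open>k\<close>
      cancels modulo \<open>Q\<close>, leaving \<open>r \<otimes> n\<close> congruent to
      \<open>b \<otimes> j\<close> with \<open>r\<close> outside \<open>M\<close>.\<close>
    have "(r \<otimes> n \<ominus> b \<otimes> j) \<otimes> k = r \<otimes> (n \<otimes> k) \<ominus> b \<otimes> (j \<otimes> k)"
      using nc jkc ab(1,2) ar(1,2) by algebra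
    also have "\<dots> = (r \<otimes> a' \<ominus> b \<otimes> a) \<otimes> p"
      unfolding ab(3) ar(3) using c ab(1,2) ar(1,2) by algebra
    finally have "(r \<otimes> n \<ominus> b \<otimes> j) \<otimes> k \<in> Q"
      using Q.I_l_closed[OF p, of "r \<otimes> a' \<ominus> b \<otimes> a"] ab ar by simp
    then have "r \<otimes> n \<ominus> b \<otimes> j \<in> Q"
      using Q.I_prime[of "r \<otimes> n \<ominus> b \<otimes> j" k] jkQ(2) jkc nc ab(2) ar(2) by auto
    then have "b \<otimes> j \<oplus> (r \<otimes> n \<ominus> b \<otimes> j) \<in> PIdl j <+> Q"
      using in_PIdlI[OF ab(2)] by (intro in_ideal_sumI)
    moreover have "b \<otimes> j \<oplus> (r \<otimes> n \<ominus> b \<otimes> j) = r \<otimes> n"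
      using nc jkc ab(2) ar(2) by algebra
    ultimately show "n \<in> sat M (PIdl j <+> Q)"
      using nc ar(2) rM by (intro satI[of n r]) simp_all
  qed
  moreover have "p \<in> N" using mem(1) ideal_prod_inter[OF N(2) K] by auto
  ultimately show ?thesis using that Nprime NM jk(1) jkQ(1) by blast
qed

lemma locally_principal_generator_divisible_if_idempotent:
  assumes M: "primeideal M R" and idem: "M \<subseteq> sat M (M \<cdot> M)"
    and Q: "primeideal Q R" and QM: "Q \<subset> M" and p: "p \<in> Q" and Qp: "Q \<subseteq> sat M (PIdl p)"
  shows "p \<in> sat M (M \<cdot> Q)"
proof -
  interpret M: primeideal M R by fact
  interpret Q: primeideal Q R by fact
  obtain N j where Nj: "primeideal N R" "N \<subseteq> M" "p \<in> N" "j \<in> N" "j \<notin> Q"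
    and Nsat: "N \<subseteq> sat M (PIdl j <+> Q)"
    using prime_principal_modulo_if_idempotent[OF M idem Q QM p] .
  interpret N: primeideal N R by fact
  have c: "p \<in> carrier R" "j \<in> carrier R" using Nj by auto
  have j2: "j \<otimes> j \<in> N" "j \<otimes> j \<notin> Q" using N.I_l_closed[OF Nj(4) c(2)] Q.mult_notin Nj(5) c by auto
  obtain N' K where N': "OA_ideal N' R" "ideal N' R" and K: "ideal K R" and N'N: "N' \<subseteq> N"
    and pj: "PIdl p <+> PIdl (j \<otimes> j) = N' \<cdot> K"
    using two_generated_factor[OF Nj(1,3) j2(1)] .
  have N'prime: "primeideal N' R"
    using OA_ideal_prime_if_idempotent[OF M idem N'(1)] N'N Nj(2) by auto
  interpret N': primeideal N' R by fact
  interpret K: ideal K R by fact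
  have mem: "p \<in> N' \<cdot> K" "j \<otimes> j \<in> N' \<cdot> K"
    using PIdl_sum_self[of p "j \<otimes> j"] c pj by auto
  then have "p \<in> N'" "j \<otimes> j \<in> N'" using ideal_prod_inter[OF N'(2) K] by auto
  then have "p \<in> N'" "j \<in> N'" using N'.I_prime c by auto
  \<comment> \<open>The prime \<open>N'\<close> lies inside \<open>M\<close>, so it contains
    whatever its elements generate locally. From \<open>p\<close> it gains \<open>Q\<close>, and
    from \<open>j\<close> and \<open>Q\<close> it gains \<open>N\<close>.\<close>
  have satN': "sat M A \<subseteq> N'" if "A \<subseteq> N'" for A
    using M.sat_prime_subset[OF N'prime] N'N Nj(2) sat_mono[OF that] by blast
  have QN': "Q \<subseteq> N'"
    using Qp satN'[OF cgenideal_minimal[OF N'(2) \<open>p \<in> N'\<close>]] by auto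
  have NN': "N \<subseteq> N'"
    using Nsat satN'[OF ideal_sum_subset[OF N'(2) cgenideal_minimal[OF N'(2) \<open>j \<in> N'\<close>] QN']] by auto
  have KN: "K \<subseteq> N"
  proof
    fix k assume k: "k \<in> K"
    then have kc: "k \<in> carrier R" by auto
    have "j \<otimes> k \<in> PIdl p <+> PIdl (j \<otimes> j)"
      unfolding pj by (rule ideal_prod.prod[OF \<open>j \<in> N'\<close> k])
    then obtain a b where ab: "a \<in> carrier R" "b \<in> carrier R" "j \<otimes> k = a \<otimes> p \<oplus> b \<otimes> (j \<otimes> j)"
      by (rule in_PIdl_sumE)
    \<comment> \<open>Cancelling \<open>j\<close> modulo \<open>Q\<close> shows that
      \<open>k\<close> is congruent to a multiple of \<open>j\<close>, so the cofactor
      \<open>K\<close> also lies in \<open>N\<close>.\<close>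
    have "j \<otimes> (k \<ominus> b \<otimes> j) = j \<otimes> k \<ominus> b \<otimes> (j \<otimes> j)" using c kc ab(1,2) by algebra
    also have "\<dots> = a \<otimes> p" unfolding ab(3) using c ab(1,2) by algebra
    finally have "j \<otimes> (k \<ominus> b \<otimes> j) \<in> Q" using Q.I_l_closed[OF p ab(1)] by simp
    then have "k \<ominus> b \<otimes> j \<in> Q" using Q.I_prime[of j "k \<ominus> b \<otimes> j"] Nj(5) c kc ab by auto
    then have "b \<otimes> j \<oplus> (k \<ominus> b \<otimes> j) \<in> N"
      using QN' N'N N.I_l_closed[OF Nj(4) ab(2)] by (intro ideal_add_closed[OF N.is_ideal]) auto
    moreover have "b \<otimes> j \<oplus> (k \<ominus> b \<otimes> j) = k" using c kc ab(2) by algebra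
    ultimately show "k \<in> N" by simp
  qed
  let ?A = "PIdl j <+> Q :: 'a set"
  let ?B = "PIdl (j \<otimes> j) <+> M \<cdot> Q :: 'a set"
  have MQ: "ideal (M \<cdot> Q) R" using ideal_prod_is_ideal[OF M.is_ideal Q.is_ideal] .
  have A: "ideal ?A R" using add_ideals[OF cgenideal_ideal[OF c(2)] Q.is_ideal] .
  have B: "ideal ?B R" using c by (intro add_ideals cgenideal_ideal MQ) simp
  \<comment> \<open>Apart from the multiple of \<open>j \<otimes> j\<close>, every term of the
    expanded product has a factor in \<open>Q\<close> and another in \<open>M\<close>.\<close>
  have "?A \<cdot> ?A \<subseteq> ?B"
  proof (rule ideal_prod_subset[OF B])
    fix u u' assume "u \<in> ?A" "u' \<in> ?A"
    then obtain b q b' q' where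
      b: "b \<in> carrier R" "q \<in> Q" "u = b \<otimes> j \<oplus> q" and
      b': "b' \<in> carrier R" "q' \<in> Q" "u' = b' \<otimes> j \<oplus> q'"
      by (auto elim!: in_ideal_sumE in_PIdlE)
    have qc: "q \<in> carrier R" "q' \<in> carrier R" using b b' by auto
    have "b \<otimes> j \<in> M" "b' \<otimes> j \<oplus> q' \<in> M"
      using M.I_l_closed b(1) b'(1,2) Nj(2,4) QM by (auto intro!: ideal_add_closed[OF M.is_ideal])
    then have "(b \<otimes> j) \<otimes> q' \<oplus> (b' \<otimes> j \<oplus> q') \<otimes> q \<in> M \<cdot> Q"
      using b(2) b'(2) by (intro ideal_prod.sum ideal_prod.prod)
    then have "(b \<otimes> b') \<otimes> (j \<otimes> j) \<oplus> ((b \<otimes> j) \<otimes> q' \<oplus> (b' \<otimes> j \<oplus> q') \<otimes> q) \<in> ?B"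
      using in_PIdlI[of "b \<otimes> b'" "j \<otimes> j"] b(1) b'(1) by (intro in_ideal_sumI) auto
    moreover have "u \<otimes> u' = (b \<otimes> b') \<otimes> (j \<otimes> j) \<oplus> ((b \<otimes> j) \<otimes> q' \<oplus> (b' \<otimes> j \<oplus> q') \<otimes> q)"
      unfolding b(3) b'(3) using b(1) b'(1) qc c by algebra
    ultimately show "u \<otimes> u' \<in> ?B" by simp
  qed
  moreover have "p \<in> sat M (?A \<cdot> ?A)"
    using mem(1) ideal_prod_mono[OF N'N KN N.is_ideal N.is_ideal] M.sat_prod_subset[OF A A Nsat Nsat]
    by blast
  ultimately have "p \<in> sat M ?B" using sat_mono by blast
  then obtain s where s: "s \<in> carrier R" "s \<notin> M" "s \<otimes> p \<in> ?B" by (rule satE)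
  then obtain e z where ez: "e \<in> carrier R" "z \<in> M \<cdot> Q" "s \<otimes> p = e \<otimes> (j \<otimes> j) \<oplus> z"
    by (auto elim!: in_ideal_sumE in_PIdlE)
  have zQ: "z \<in> Q" using ez(2) ideal_prod_inter[OF M.is_ideal Q.is_ideal] by auto
  then have zc: "z \<in> carrier R" by auto
  \<comment> \<open>As \<open>j \<otimes> j\<close> is outside \<open>Q\<close>, the coefficient
    \<open>e\<close> lies in \<open>Q\<close>; as \<open>j \<otimes> j\<close> is in
    \<open>M\<close>, the term is absorbed by \<open>M \<cdot> Q\<close>.\<close>
  have "e \<otimes> (j \<otimes> j) = s \<otimes> p \<ominus> z" unfolding ez(3) using ez(1) zc c by algebra
  also have "\<dots> \<in> Q" using Q.I_l_closed[OF p s(1)] zQ by (rule ideal_minus_closed[OF Q.is_ideal])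
  finally have "e \<in> Q" using Q.I_prime[of e "j \<otimes> j"] j2(2) c ez(1) by auto
  then have "(j \<otimes> j) \<otimes> e \<oplus> z \<in> M \<cdot> Q"
    using j2(1) Nj(2) ez(2) by (intro ideal_prod.sum ideal_prod.prod) auto
  then have "s \<otimes> p \<in> M \<cdot> Q" using ez c m_comm[of "j \<otimes> j" e] by simp
  with c(1) s(1,2) show ?thesis by (rule satI)
qed

text \<open>In the idempotent case \<open>Q\<close> is not known to be locally principal, so the
  preceding lemma is applied to the factor \<open>J\<close> of the ideal of \<open>p\<close>. If
  \<open>K\<close> is not inside \<open>M\<close>, this \<open>J\<close> is a prime locally
  generated by \<open>p\<close>; if \<open>K\<close> is inside \<open>M\<close>, then
  \<open>p\<close> lies in \<open>M \<cdot> Q\<close> outright.\<close>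

lemma nonmaximal_prime_locally_divisible:
  assumes M: "primeideal M R" and Q: "primeideal Q R" and QM: "Q \<subset> M"
  shows "Q \<subseteq> sat M (M \<cdot> Q)"
proof (cases "M \<subseteq> sat M (M \<cdot> M)")
  case False
  then show ?thesis by (rule nonmaximal_prime_locally_divisible_if_not_idempotent[OF M _ Q QM])
next
  case True
  interpret M: primeideal M R by fact
  interpret Q: primeideal Q R by fact
  have MQ: "ideal (M \<cdot> Q) R" using ideal_prod_is_ideal[OF M.is_ideal Q.is_ideal] .
  show ?thesis
  proof
    fix p assume p: "p \<in> Q"
    obtain J K where J: "OA_ideal J R" "ideal J R" "J \<subseteq> Q" and K: "ideal K R"
      and pJK: "PIdl p = J \<cdot> K"
      using principal_factor[OF Q p] .
    have pmem: "p \<in> J \<cdot> K" using cgenideal_self[of p] p pJK by auto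
    show "p \<in> sat M (M \<cdot> Q)"
    proof (cases "K \<subseteq> M")
      case True
      have "J \<cdot> K \<subseteq> M \<cdot> Q"
        using ideal_prod_mono[OF J(3) True Q.is_ideal M.is_ideal]
          ideal_prod_commute[OF Q.is_ideal M.is_ideal] by simp
      with pmem M.subset_sat[OF MQ] show ?thesis by blast
    next
      case False
      have Jp: "primeideal J R" by (rule OA_ideal_below_nonmaximal_prime[OF J(1,3) Q M QM])
      have "p \<in> J" using pmem ideal_prod_inter[OF J(2) K] by auto
      moreover have "J \<subseteq> sat M (PIdl p)"
        unfolding pJK by (rule M.factor_subset_sat_prod[OF J(2) K False])
      ultimately have "p \<in> sat M (M \<cdot> J)"
        using locally_principal_generator_divisible_if_idempotent[OF M True Jp] J(3) QM by auto
      moreover have "M \<cdot> J \<subseteq> M \<cdot> Q"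
        using ideal_prod_mono[OF _ J(3) M.is_ideal Q.is_ideal] by auto
      ultimately show ?thesis using sat_mono by blast
    qed
  qed
qed

section \<open>Local vanishing and the dimension bound\<close>

lemma nonmaximal_prime_locally_zero:
  assumes M: "primeideal M R" and P: "primeideal P R" and PM: "P \<subset> M"
  shows "P \<subseteq> sat M {\<zero>}"
proof
  interpret M: primeideal M R by fact
  interpret P: primeideal P R by fact
  fix y assume y: "y \<in> P"
  then have yc: "y \<in> carrier R" by auto
  obtain J K where J: "OA_ideal J R" "ideal J R" "J \<subseteq> P" and K: "ideal K R"
    and yJK: "PIdl y = J \<cdot> K"
    using principal_factor[OF P y] .
  have Jp: "primeideal J R" by (rule OA_ideal_below_nonmaximal_prime[OF J(1,3) P M PM])
  then have "J \<subseteq> sat M (M \<cdot> J)"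
    using nonmaximal_prime_locally_divisible[OF M] J(3) PM by auto
  then have "J \<cdot> K \<subseteq> sat M ((M \<cdot> J) \<cdot> K)"
    using M.sat_prod_subset[OF ideal_prod_is_ideal[OF M.is_ideal J(2)] K] M.subset_sat[OF K] by auto
  then have "y \<in> sat M (M \<cdot> (PIdl y))"
    using cgenideal_self[OF yc] ideal_prod_assoc[OF M.is_ideal J(2) K] yJK by auto
  then obtain s where s: "s \<in> carrier R" "s \<notin> M" "s \<otimes> y \<in> M \<cdot> (PIdl y)" by (rule satE)
  \<comment> \<open>Nakayama for a cyclic module: \<open>s \<ominus> m\<close> is outside
    \<open>M\<close> and annihilates \<open>y\<close>.\<close>
  from ideal_prod_PIdlE[OF M.is_ideal yc s(3)] obtain m where m: "m \<in> M" "s \<otimes> y = m \<otimes> y" .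
  have mc: "m \<in> carrier R" using m by auto
  have "(s \<ominus> m) \<otimes> y = s \<otimes> y \<ominus> m \<otimes> y" using s(1) mc yc by algebra
  also have "\<dots> = \<zero>" unfolding m(2) using mc yc by algebra
  finally show "y \<in> sat M {\<zero>}"
    using M.minus_notin[OF s(1,2) m(1)] yc s(1) mc by (intro satI[of y "s \<ominus> m"]) simp_all
qed

lemma no_prime_chain_of_length_two:
  assumes P: "primeideal P R" and Q: "primeideal Q R" and M: "primeideal M R" and "P \<subset> Q" "Q \<subset> M"
  shows False
proof -
  interpret M: primeideal M R by fact
  interpret P: primeideal P R by fact
  have "P \<subseteq> M" "\<not> Q \<subseteq> P" using assms(4,5) by blast+
  have "{\<zero>} \<subseteq> P" using P.zero_closed by simp
  have "Q \<subseteq> sat M {\<zero>}" by (rule nonmaximal_prime_locally_zero[OF M Q assms(5)])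
  also have "\<dots> \<subseteq> sat M P" by (rule sat_mono) fact
  also have "\<dots> \<subseteq> P" by (rule M.sat_prime_subset[OF P]) fact
  finally show False using \<open>\<not> Q \<subseteq> P\<close> by contradiction
qed

end

theorem theorem3p5:
  fixes R :: "('a, 'b) ring_scheme"
  assumes "cring R"
    and "\<one>\<^bsub>R\<^esub> \<noteq> \<zero>\<^bsub>R\<^esub>"
    and "\<And>I. proper_ideal I R \<Longrightarrow> two_generated R I \<Longrightarrow> \<exists>Js. OA_factorization R Js I"
  shows "krull_dim R \<le> 1"
proof -
  interpret two_generated_OA R
    using assms(1,3) by (intro two_generated_OA.intro two_generated_OA_axioms.intro)
  have "n \<le> 1"
    if "length Ps = Suc n" "\<forall>P\<in>set Ps. primeideal P R" "sorted_wrt (\<subset>) Ps" for n Ps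
  proof (rule ccontr)
    assume "\<not> n \<le> 1"
    \<comment> \<open>A chain of \<open>Suc n\<close> primes has length \<open>n\<close>, so
      \<open>n\<close> at least 2 provides three primes, at indices 0, 1 and 2.\<close>
    with that(1) have "2 < length Ps" by simp
    then have "Ps ! 0 \<in> set Ps" "Ps ! 1 \<in> set Ps" "Ps ! 2 \<in> set Ps"
      by (auto intro!: nth_mem)
    with that(2,3) \<open>2 < length Ps\<close> have "primeideal (Ps ! 0) R" "primeideal (Ps ! 1) R" "primeideal (Ps ! 2) R"
      "Ps ! 0 \<subset> Ps ! 1" "Ps ! 1 \<subset> Ps ! 2"
      by (auto simp: sorted_wrt_iff_nth_less)
    then show False by (rule no_prime_chain_of_length_two)
  qed
  then show ?thesis
    unfolding krull_dim_def by (intro Sup_least) (auto simp: one_enat_def)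
qed

end
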